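(* Let $G$ be a simple connected graph with vertices $v_1,\dots,v_n$ and adjacency matrix $\mathbf{A}=\mathbf{A}(G)=(a_{i,j})$. Let $v_\ell$ and $v_k$ ($\ell\neq k$) be twin vertices of $G$, and let $h_{\ell,k}=h_{\ell,k}(\lambda)$ denote the entry in row $\ell$ and column $k$ of $\operatorname{adj}(\lambda\mathbf{I}-\mathbf{A})$. Then $$\phi(\mathbf{A}(G),\lambda)=(\lambda+a_{\ell,k})\left[\phi(\mathbf{A}(G_{-v_\ell}),\lambda)-h_{\ell,k}\right].$$
   Context: The adjacency matrix has $a_{i,j}=1$ if $v_i,v_j$ are adjacent and $a_{i,j}=0$ otherwise. Two distinct vertices are twins if they are duplicates (non-adjacent with the same neighbours) or co-duplicates (adjacent, and duplicate vertices in the complement of $G$, i.e. with the same neighbours among the remaining vertices). For a square matrix $\mathbf{M}$, $\phi(\mathbf{M},\lambda)=\det(\lambda\mathbf{I}-\mathbf{M})$ is its characteristic polynomial, and $\operatorname{adj}$ denotes the adjugate matrix. $G_{-v}$ is the graph obtained from $G$ by deleting vertex $v$ and its incident edges. *)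

theory Defs
  imports "Graph_Theory.Graph_Theory" "Jordan_Normal_Form.Char_Poly"
begin

text \<open>
  Simple graphs are those of the locale \<open>graph\<close>: finite, loop-free symmetric digraphs without
  parallel arcs, each edge being represented by its two opposite arcs. Hence
  \<open>u \<rightarrow>\<^bsub>G\<^esub> v\<close> is adjacency.
\<close>

definition nbhd :: "('a, 'b) pre_digraph \<Rightarrow> 'a \<Rightarrow> 'a set" where
  "nbhd G u = {w. u \<rightarrow>\<^bsub>G\<^esub> w}"

definition graph_complement :: "('a, 'b) pre_digraph \<Rightarrow> ('a, 'a \<times> 'a) pre_digraph" where
  "graph_complement G =
    \<lparr> verts = verts G,
      arcs = {(u, v). u \<in> verts G \<and> v \<in> verts G \<and> u \<noteq> v \<and> \<not> u \<rightarrow>\<^bsub>G\<^esub> v},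
      tail = fst, head = snd \<rparr>"

definition duplicates :: "('a, 'b) pre_digraph \<Rightarrow> 'a \<Rightarrow> 'a \<Rightarrow> bool" where
  "duplicates G u v \<longleftrightarrow>
    u \<in> verts G \<and> v \<in> verts G \<and> u \<noteq> v \<and> \<not> u \<rightarrow>\<^bsub>G\<^esub> v \<and> nbhd G u = nbhd G v"

definition co_duplicates :: "('a, 'b) pre_digraph \<Rightarrow> 'a \<Rightarrow> 'a \<Rightarrow> bool" where
  "co_duplicates G u v \<longleftrightarrow> u \<rightarrow>\<^bsub>G\<^esub> v \<and> duplicates (graph_complement G) u v"

definition twins :: "('a, 'b) pre_digraph \<Rightarrow> 'a \<Rightarrow> 'a \<Rightarrow> bool" where
  "twins G u v \<longleftrightarrow> duplicates G u v \<or> co_duplicates G u v"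

text \<open>A list of the vertices \<open>v\<^sub>1, \<dots>, v\<^sub>n\<close>; list positions, like matrix indices, start at 0.\<close>

definition vertex_list :: "('a, 'b) pre_digraph \<Rightarrow> 'a list \<Rightarrow> bool" where
  "vertex_list G vs \<longleftrightarrow> distinct vs \<and> set vs = verts G"

definition adjacency_matrix :: "('a, 'b) pre_digraph \<Rightarrow> 'a list \<Rightarrow> real mat" where
  "adjacency_matrix G vs =
    mat (length vs) (length vs) (\<lambda>(i, j). if vs ! i \<rightarrow>\<^bsub>G\<^esub> vs ! j then 1 else 0)"

lemma arcs_ends_graph_complement:
  "arcs_ends (graph_complement G) =
    {(u, v). u \<in> verts G \<and> v \<in> verts G \<and> u \<noteq> v \<and> \<not> u \<rightarrow>\<^bsub>G\<^esub> v}"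
  by (auto simp: arcs_ends_def arc_to_ends_def graph_complement_def)

lemma (in graph) co_duplicates_iff:
  "co_duplicates G u v \<longleftrightarrow> u \<rightarrow>\<^bsub>G\<^esub> v \<and> nbhd G u - {v} = nbhd G v - {u}"
proof (cases "u \<rightarrow>\<^bsub>G\<^esub> v")
  case True
  have in_verts: "y \<in> verts G" if "x \<rightarrow>\<^bsub>G\<^esub> y" for x y
    using that adj_in_verts(2) by blast
  have irrefl: "\<not> x \<rightarrow>\<^bsub>G\<^esub> x" for x
    using adj_not_same by blast
  have vu: "v \<rightarrow>\<^bsub>G\<^esub> u"
    using True arcs_ends_symmetric[OF sym_arcs] by blast
  have uv: "u \<in> verts G" "v \<in> verts G" "u \<noteq> v"
    using True vu in_verts irrefl by auto
  have nbhd_compl: "nbhd (graph_complement G) x = verts G - {x} - nbhd G x" if "x \<in> verts G" for x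
    using that by (auto simp: nbhd_def arcs_ends_graph_complement)
  have "co_duplicates G u v \<longleftrightarrow> nbhd (graph_complement G) u = nbhd (graph_complement G) v"
    using True uv
    by (simp add: co_duplicates_def duplicates_def arcs_ends_graph_complement)
      (simp add: graph_complement_def)
  also have "\<dots> \<longleftrightarrow> verts G - {u} - nbhd G u = verts G - {v} - nbhd G v"
    using uv by (simp add: nbhd_compl)
  also have "\<dots> \<longleftrightarrow> nbhd G u - {v} = nbhd G v - {u}"
  proof -
    have "nbhd G u \<subseteq> verts G" "nbhd G v \<subseteq> verts G" "u \<notin> nbhd G u" "v \<notin> nbhd G v"
      "v \<in> nbhd G u" "u \<in> nbhd G v"
      using in_verts irrefl True vu by (auto simp: nbhd_def)
    then show ?thesis
      by blast
  qed
  finally show ?thesis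
    using True by blast
qed (simp add: co_duplicates_def)

end

(* Columns l and k of M = \<lambda>I - A agree outside rows l and k, and their difference is
   (\<lambda> + a) (e_l - e_k). Comparing the entries (l, l) and (l, k) of adj M * M = det M * I
   therefore gives det M = (\<lambda> + a) (adj M (l, l) - adj M (l, k)), and adj M (l, l) is the
   principal minor obtained by deleting v_l. *)

theory Submission
  imports Defs
begin

text \<open>The identity involves no division, so it holds over any commutative ring. This allows
  \<open>M\<close> to be the polynomial matrix \<lambda>I - A, with \<open>c\<close> the polynomial
  \<lambda> + a.\<close>

lemma det_eq_adj_mat_diff:
  fixes M :: "'a :: comm_ring_1 mat"
  assumes M: "M \<in> carrier_mat n n" and lk: "l < n" "k < n" "l \<noteq> k"
    and same: "\<And>j. \<lbrakk>j < n; j \<noteq> l; j \<noteq> k\<rbrakk> \<Longrightarrow> M $$ (j, l) = M $$ (j, k)"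
    and diff: "M $$ (l, l) - M $$ (l, k) = c" "M $$ (k, l) - M $$ (k, k) = - c"
  shows "det M = c * (adj_mat M $$ (l, l) - adj_mat M $$ (l, k))"
proof -
  have entry: "(adj_mat M * M) $$ (l, j) = (\<Sum>i<n. adj_mat M $$ (l, i) * M $$ (i, j))"
    if "j < n" for j
    using that lk M adj_mat(1)[OF M] by (simp add: scalar_prod_def atLeast0LessThan)
  have "det M = (adj_mat M * M) $$ (l, l) - (adj_mat M * M) $$ (l, k)"
    unfolding adj_mat(3)[OF M] using lk by simp
  also have "\<dots> = (\<Sum>i<n. adj_mat M $$ (l, i) * (M $$ (i, l) - M $$ (i, k)))"
    using lk by (simp add: entry sum_subtractf right_diff_distrib)
  \<comment> \<open>By \<open>same\<close>, columns \<open>l\<close> and \<open>k\<close> cancel in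
    every other row.\<close>
  also have "\<dots> = (\<Sum>i\<in>{l, k}. adj_mat M $$ (l, i) * (M $$ (i, l) - M $$ (i, k)))"
    using lk same by (intro sum.mono_neutral_right) auto
  also have "\<dots> = c * (adj_mat M $$ (l, l) - adj_mat M $$ (l, k))"
    using lk(3) by (simp add: diff) (simp add: algebra_simps)
  finally show ?thesis .
qed

text \<open>Permuting the rows and permuting the columns each contribute a factor
  \<open>signof p\<close>, and the two signs cancel.\<close>

lemma det_permute_rows_cols:
  fixes A :: "'a :: comm_ring_1 mat"
  assumes A: "A \<in> carrier_mat n n" and p: "p permutes {0..<n}"
  shows "det (mat n n (\<lambda>(i, j). A $$ (p i, p j))) = det A"
proof -
  let ?B = "mat n n (\<lambda>(i, j). A $$ (p i, j))"
  have p_less: "p i < n" if "i < n" for i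
    using permutes_in_image[OF p, of i] that by simp
  \<comment> \<open>The columns of \<open>?B\<close> are permuted as rows of its transpose.\<close>
  have "det (mat n n (\<lambda>(i, j). A $$ (p i, p j))) =
      det (transpose_mat (mat n n (\<lambda>(i, j). transpose_mat ?B $$ (p i, j))))"
    by (intro arg_cong[where f = det] eq_matI) (auto simp: p_less)
  also have "\<dots> = det (mat n n (\<lambda>(i, j). transpose_mat ?B $$ (p i, j)))"
    by (rule det_transpose[of _ n]) simp
  also have "\<dots> = signof p * det (transpose_mat ?B)"
    by (rule det_permute_rows[OF _ p]) simp
  also have "det (transpose_mat ?B) = signof p * det A"
    using det_transpose[of ?B n] det_permute_rows[OF A p] by simp
  finally show ?thesis
    by (simp add: sign_def)
qed

lemma index_char_poly_matrix:
  assumes "A \<in> carrier_mat n n" "i < n" "j < n"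
  shows "char_poly_matrix A $$ (i, j) = (if i = j then [:0, 1:] else 0) + [:- A $$ (i, j):]"
  using assms by (simp add: char_poly_matrix_def)

text \<open>Since \<open>p\<close> is injective, it sends diagonal positions to diagonal positions
  and no others. Relabelling therefore commutes with forming \<lambda>I - A, and the determinant is
  unchanged.\<close>

lemma char_poly_permute_rows_cols:
  assumes A: "A \<in> carrier_mat n n" and p: "p permutes {0..<n}"
  shows "char_poly (mat n n (\<lambda>(i, j). A $$ (p i, p j))) = char_poly A"
proof -
  have p_less: "p i < n" if "i < n" for i
    using permutes_in_image[OF p, of i] that by simp
  have p_eq: "p i = p j \<longleftrightarrow> i = j" for i j
    using permutes_inj[OF p] by (auto dest: injD)
  have "char_poly_matrix (mat n n (\<lambda>(i, j). A $$ (p i, p j))) =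
      mat n n (\<lambda>(i, j). char_poly_matrix A $$ (p i, p j))"
    using A by (intro eq_matI)
      (auto simp: index_char_poly_matrix[where n = n] p_less p_eq char_poly_matrix_def)
  then show ?thesis
    unfolding char_poly_def
    using det_permute_rows_cols[OF char_poly_matrix_closed[OF A] p] by simp
qed

lemma mat_delete_char_poly_matrix:
  assumes A: "A \<in> carrier_mat n n" and l: "l < n"
  shows "mat_delete (char_poly_matrix A) l l = char_poly_matrix (mat_delete A l l)"
  using A l by (intro eq_matI) (auto simp: mat_delete_def char_poly_matrix_def)

lemma adj_mat_char_poly_matrix_diag:
  assumes "A \<in> carrier_mat n n" and "l < n"
  shows "adj_mat (char_poly_matrix A) $$ (l, l) = char_poly (mat_delete A l l)"
proof -
  have "dim_row (char_poly_matrix A) = n" "dim_col (char_poly_matrix A) = n"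
    using char_poly_matrix_closed[OF assms(1)] by auto
  then show ?thesis
    \<comment> \<open>The cofactor sign (-1)^(l + l) is 1; folding \<open>l + l\<close> into
      \<open>2 * l\<close> exposes the even exponent.\<close>
    using assms mat_delete_char_poly_matrix[OF assms]
    by (simp add: adj_mat_def cofactor_def char_poly_def flip: mult_2)
qed

text \<open>Reordering the vertices permutes rows and columns simultaneously. This makes the choice
  of the enumeration \<open>ws\<close> of the smaller graph irrelevant.\<close>

lemma char_poly_adjacency_matrix_mset_eq:
  assumes "mset ws = mset us"
  shows "char_poly (adjacency_matrix G ws) = char_poly (adjacency_matrix G us)"
proof -
  let ?n = "length us"
  obtain p where p: "p permutes {..<?n}" and ws: "permute_list p us = ws"
    using mset_eq_permutation[OF assms] by blast
  have p_less: "p i < ?n" if "i < ?n" for i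
    using permutes_in_image[OF p, of i] that by simp
  have len: "length ws = ?n"
    using ws by (metis length_permute_list)
  have nth: "ws ! i = us ! p i" if "i < ?n" for i
    using permute_list_nth[OF p that] ws by simp
  have "adjacency_matrix G ws = mat ?n ?n (\<lambda>(i, j). adjacency_matrix G us $$ (p i, p j))"
    by (intro eq_matI) (auto simp: adjacency_matrix_def len nth p_less)
  then show ?thesis
    using char_poly_permute_rows_cols[of "adjacency_matrix G us" ?n p] p
    by (simp add: adjacency_matrix_def atLeast0LessThan)
qed

lemma adj_del_vert:
  "u \<rightarrow>\<^bsub>pre_digraph.del_vert G x\<^esub> v \<longleftrightarrow> u \<rightarrow>\<^bsub>G\<^esub> v \<and> u \<noteq> x \<and> v \<noteq> x"
  by (auto simp: arcs_ends_def arc_to_ends_def pre_digraph.del_vert_def)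

lemma mat_delete_adjacency_matrix:
  assumes "distinct vs" and l: "l < length vs"
  shows "mat_delete (adjacency_matrix G vs) l l =
    adjacency_matrix (pre_digraph.del_vert G (vs ! l)) (take l vs @ drop (Suc l) vs)"
    (is "_ = adjacency_matrix ?H ?us")
proof -
  have len: "length ?us = length vs - 1"
    using l by simp
  \<comment> \<open>Positions from \<open>l\<close> on shift by one, which is exactly the reindexing
    done by \<open>mat_delete\<close>.\<close>
  have nth: "?us ! i = vs ! (if i < l then i else Suc i)" if "i < length vs - 1" for i
    using that l by (auto simp: nth_append min_def)
  \<comment> \<open>As \<open>vs\<close> is distinct, no remaining position holds the deleted
    vertex, so all adjacencies among the remaining positions survive.\<close>
  have neq: "vs ! (if i < l then i else Suc i) \<noteq> vs ! l" if "i < length vs - 1" for i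
    using that l assms(1) by (auto simp: nth_eq_iff_index_eq)
  show ?thesis
    by (intro eq_matI)
      (auto simp: mat_delete_def adjacency_matrix_def adj_del_vert len nth neq simp del: length_append)
qed

text \<open>The given list \<open>ws\<close> is a rearrangement of \<open>vs\<close> with position
  \<open>l\<close> removed, and for that list the adjacency matrix is the principal submatrix whose
  characteristic polynomial is the diagonal adjugate entry.\<close>

lemma char_poly_adjacency_matrix_del_vert:
  assumes vs: "vertex_list G vs" and l: "l < length vs"
    and ws: "vertex_list (pre_digraph.del_vert G (vs ! l)) ws"
  shows "char_poly (adjacency_matrix (pre_digraph.del_vert G (vs ! l)) ws) =
    adj_mat (char_poly_matrix (adjacency_matrix G vs)) $$ (l, l)"
proof -
  let ?us = "take l vs @ drop (Suc l) vs"
  have dist: "distinct vs" "set vs = verts G"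
    using vs by (auto simp: vertex_list_def)
  have vs_eq: "take l vs @ vs ! l # drop (Suc l) vs = vs"
    using l by (simp add: id_take_nth_drop[symmetric])
  then have "distinct (take l vs @ vs ! l # drop (Suc l) vs)"
    "set vs = set (take l vs @ vs ! l # drop (Suc l) vs)"
    using dist(1) by simp_all
  then have us: "distinct ?us" "set ?us = set vs - {vs ! l}"
    by auto
  have "mset ws = mset ?us"
    using us ws dist set_eq_iff_mset_eq_distinct[of ws ?us]
    by (auto simp: vertex_list_def pre_digraph.verts_del_vert)
  then have "char_poly (adjacency_matrix (pre_digraph.del_vert G (vs ! l)) ws) =
      char_poly (mat_delete (adjacency_matrix G vs) l l)"
    using mat_delete_adjacency_matrix[OF dist(1) l, of G]
    by (simp add: char_poly_adjacency_matrix_mset_eq)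
  then show ?thesis
    using adj_mat_char_poly_matrix_diag[of "adjacency_matrix G vs" "length vs" l] l
    by (simp add: adjacency_matrix_def)
qed

text \<open>For both kinds of twins the neighbourhoods agree outside \<open>u\<close> and
  \<open>v\<close>. Symmetry turns this into a statement on arcs into \<open>u\<close> and
  \<open>v\<close>, the form needed to compare columns of the adjacency matrix.\<close>

lemma (in graph) twins_adj_iff:
  assumes "twins G u v" "w \<noteq> u" "w \<noteq> v"
  shows "w \<rightarrow>\<^bsub>G\<^esub> u \<longleftrightarrow> w \<rightarrow>\<^bsub>G\<^esub> v"
proof -
  have "nbhd G u - {v} = nbhd G v - {u} \<or> nbhd G u = nbhd G v"
    using assms(1) by (auto simp: twins_def co_duplicates_iff duplicates_def)
  then have "u \<rightarrow>\<^bsub>G\<^esub> w \<longleftrightarrow> v \<rightarrow>\<^bsub>G\<^esub> w"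
    using assms(2,3) by (auto simp: nbhd_def set_eq_iff)
  then show ?thesis
    using arcs_ends_symmetric[OF sym_arcs] by blast
qed

theorem theorem13:
  fixes G :: "('a, 'b) pre_digraph" and vs ws :: "'a list" and l k :: nat
  assumes "graph G" and "connected G"
    and "vertex_list G vs"
    and "l < length vs" and "k < length vs" and "l \<noteq> k"
    and "twins G (vs ! l) (vs ! k)"
    and "vertex_list (pre_digraph.del_vert G (vs ! l)) ws"
  defines "A \<equiv> adjacency_matrix G vs"
    and "h \<equiv> adj_mat (char_poly_matrix (adjacency_matrix G vs)) $$ (l, k)"
  shows "char_poly A =
    ([:0, 1:] + [:A $$ (l, k):]) *
      (char_poly (adjacency_matrix (pre_digraph.del_vert G (vs ! l)) ws) - h)"
proof -
  interpret graph G
    by fact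
  let ?n = "length vs" and ?M = "char_poly_matrix A"
  have A: "A \<in> carrier_mat ?n ?n"
    by (simp add: A_def adjacency_matrix_def)
  have A_index: "A $$ (i, j) = (if vs ! i \<rightarrow>\<^bsub>G\<^esub> vs ! j then 1 else 0)" if "i < ?n" "j < ?n" for i j
    using that by (simp add: A_def adjacency_matrix_def)
  have irrefl: "\<not> x \<rightarrow>\<^bsub>G\<^esub> x" for x
    using adj_not_same by blast
  have diag: "A $$ (i, i) = 0" if "i < ?n" for i
    using that by (simp add: A_index irrefl)
  have sym: "A $$ (k, l) = A $$ (l, k)"
    using assms(4,5) arcs_ends_symmetric[OF sym_arcs] by (auto simp: A_index)
  have twin: "A $$ (j, l) = A $$ (j, k)" if "j < ?n" "j \<noteq> l" "j \<noteq> k" for j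
    using twins_adj_iff[OF assms(7), of "vs ! j"] that assms(3-5)
    by (simp add: A_index vertex_list_def nth_eq_iff_index_eq)
  \<comment> \<open>With a the entry \<open>A $$ (l, k)\<close>, the zero diagonal and the symmetry
    of \<open>A\<close> make the column difference \<lambda> - (-a) = \<lambda> + a in row
    \<open>l\<close> and -a - \<lambda> in row \<open>k\<close>.\<close>
  have "det ?M = ([:0, 1:] + [:A $$ (l, k):]) * (adj_mat ?M $$ (l, l) - adj_mat ?M $$ (l, k))"
    using A assms(4-6)
    by (intro det_eq_adj_mat_diff[of _ ?n])
      (auto simp: index_char_poly_matrix[OF A] diag sym twin)
  then show ?thesis
    using char_poly_adjacency_matrix_del_vert[OF assms(3,4,8)]
    by (simp add: char_poly_def A_def h_def)
qed

end
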